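(* For every $n\in\mathbb{N}$, $F(\mathcal{Q}_n)=\mathcal{F}_n$ and $Q(\mathcal{F}_n)=\mathcal{Q}_n$.
   Context: All sequences are integer sequences indexed from 1. $\mathcal{Q}$ is the set of all infinite sequences $(q(n))_{n\in\mathbb{N}}$ with $1\le q(n)\le n$ for all $n\in\mathbb{N}$. For $q\in\mathcal{Q}$, $F(q)$ denotes the sequence $f$ with $f(1)=0$ and $f(n)=q(n)-q(n-q(n-1))$ for $n>1$. $\mathcal{F}:=\{F(q): q\in\mathcal{Q}\}$. For $f\in\mathcal{F}$, $Q(f)$ denotes the sequence $q$ computed from $f$ by $q(1)=1$ and $q(n)=q(n-q(n-1))+f(n)$ for $n>1$. $\mathcal{Q}_n$ (respectively $\mathcal{F}_n$) is the set of length-$n$ sequences formed by the first $n$ terms of the sequences in $\mathcal{Q}$ (respectively $\mathcal{F}$); $F$ and $Q$ are applied to finite sequences of length $n$ by the same formulas. *)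

theory Defs
  imports "HOL-Library.FuncSet"
begin

text \<open>
  A sequence indexed by \<open>I\<close> is an extensional function on \<open>I\<close>, i.e. it has the value \<open>undefined\<close>
  off \<open>I\<close>.  Here \<open>I = {1..}\<close> for infinite sequences and \<open>I = {1..n}\<close> for sequences of
  length \<open>n\<close>, so that equality of sequences is equality of functions.
\<close>

definition seqQ :: "(nat \<Rightarrow> int) set" where
  "seqQ = (\<Pi>\<^sub>E n\<in>{1..}. {1..int n})"

text \<open>
  The index set is an argument so that one formula serves infinite and finite sequences.
  If \<open>1 \<le> q (n - 1) \<le> n - 1\<close>, as is the case for the sequences of interest,
  then \<open>nat (int n - q (n - 1))\<close> is the integer \<open>n - q (n - 1)\<close> and lies in \<open>{1..n - 1}\<close>.
\<close>

definition opF :: "nat set \<Rightarrow> (nat \<Rightarrow> int) \<Rightarrow> nat \<Rightarrow> int" where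
  "opF I q = (\<lambda>n\<in>I. if n = 1 then 0 else q n - q (nat (int n - q (n - 1))))"

definition seqF :: "(nat \<Rightarrow> int) set" where
  "seqF = opF {1..} ` seqQ"

text \<open>
  The recursion \<open>q 1 = 1\<close> and \<open>q n = q (n - q (n - 1)) + f n\<close> makes sense only as long
  as \<open>n - q (n - 1)\<close> is the index of an earlier term; a reference to any other
  index is given the value \<open>undefined\<close>.
\<close>

function recQ :: "(nat \<Rightarrow> int) \<Rightarrow> nat \<Rightarrow> int" where
  "recQ f n =
    (if n = 0 then undefined
     else if n = 1 then 1
     else (if 1 \<le> int n - recQ f (n - 1) \<and> int n - recQ f (n - 1) < int n
           then recQ f (nat (int n - recQ f (n - 1)))
           else undefined) + f n)"
  by pat_completeness auto
termination
  by (relation "measure snd") auto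

declare recQ.simps [simp del]

definition opQ :: "nat set \<Rightarrow> (nat \<Rightarrow> int) \<Rightarrow> nat \<Rightarrow> int" where
  "opQ I f = (\<lambda>n\<in>I. recQ f n)"

definition initial_segments :: "nat \<Rightarrow> (nat \<Rightarrow> int) set \<Rightarrow> (nat \<Rightarrow> int) set" where
  "initial_segments n S = (\<lambda>s. restrict s {1..n}) ` S"

end

theory Submission
  imports Defs
begin

text \<open>
  For \<open>q\<close> in \<open>seqQ\<close> and \<open>m \<ge> 2\<close> the index \<open>m - q (m - 1)\<close> lies in \<open>{1..m - 1}\<close>.  Hence the first
  \<open>n\<close> terms of \<open>F(q)\<close> depend only on the first \<open>n\<close> terms of \<open>q\<close>, i.e. \<open>F\<close> commutes with truncation
  (\<open>opF_restrict\<close>).  For the same reason the recursion for \<open>Q\<close> only ever looks up earlier terms,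
  so by strong induction it recovers \<open>q\<close> from \<open>F(q)\<close>, and its first \<open>n\<close> terms are recovered from
  the first \<open>n\<close> terms of \<open>F(q)\<close> (\<open>opQ_restrict_opF\<close>).  The two image equations are these two
  identities, taken over all \<open>q\<close> in \<open>seqQ\<close>.
\<close>

lemma seqQ_bounds:
  assumes "q \<in> seqQ" "1 \<le> k"
  shows "1 \<le> q k" "q k \<le> int k"
  using assms by (auto simp: seqQ_def dest!: PiE_mem)

lemma seqQ_backward_index:
  assumes "q \<in> seqQ" "2 \<le> m"
  shows "1 \<le> int m - q (m - 1)" "int m - q (m - 1) < int m"
proof -
  have "1 \<le> m - 1" using assms(2) by arith
  from seqQ_bounds[OF assms(1) this] assms(2)
  show "1 \<le> int m - q (m - 1)" "int m - q (m - 1) < int m"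
    by (simp_all add: of_nat_diff)
qed

lemma opF_restrict:
  assumes "q \<in> seqQ"
  shows "opF {1..n} (restrict q {1..n}) = restrict (opF {1..} q) {1..n}"
proof
  fix m
  consider "m \<notin> {1..n}" | "m \<in> {1..n}" "m = 1" | "m \<in> {1..n}" "2 \<le> m"
    by fastforce
  then show "opF {1..n} (restrict q {1..n}) m = restrict (opF {1..} q) {1..n} m"
  proof cases
    case 3
    then have "m - 1 \<in> {1..n}" by auto
    moreover have "nat (int m - q (m - 1)) \<in> {1..n}"
      using seqQ_backward_index[OF assms 3(2)] 3(1) by auto
    ultimately show ?thesis
      using 3 by (simp add: opF_def)
  qed (auto simp: opF_def)
qed

text \<open>
  Agreement of \<open>f\<close> with \<open>F(q)\<close> is only asked for up to \<open>n\<close>, so that the lemma applies to a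
  truncation of \<open>F(q)\<close> as it stands.
\<close>

lemma recQ_inverts_opF:
  assumes q: "q \<in> seqQ" and f: "\<And>k. k \<in> {1..n} \<Longrightarrow> f k = opF {1..} q k"
    and "m \<in> {1..n}"
  shows "recQ f m = q m"
  using \<open>m \<in> {1..n}\<close>
proof (induction m rule: less_induct)
  case (less m)
  show ?case
  proof (cases "m = 1")
    case True
    then show ?thesis
      using seqQ_bounds[OF q, of 1] by (simp add: recQ.simps)
  next
    case False
    then have m: "2 \<le> m" using less.prems by auto
    let ?i = "nat (int m - q (m - 1))"
    note bounds = seqQ_backward_index[OF q m]
    have "m - 1 \<in> {1..n}" "m - 1 < m"
      using less.prems m unfolding atLeastAtMost_iff by arith+
    then have prev: "recQ f (m - 1) = q (m - 1)"
      using less.IH by blast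
    have "recQ f ?i = q ?i"
      using less.IH[of ?i] less.prems bounds by auto
    then have "recQ f m = q ?i + f m"
      using m bounds prev by (subst recQ.simps) simp
    also have "f m = q m - q ?i"
      using f[OF less.prems] m by (simp add: opF_def)
    finally show ?thesis by simp
  qed
qed

lemma opQ_restrict_opF:
  assumes "q \<in> seqQ"
  shows "opQ {1..n} (restrict (opF {1..} q) {1..n}) = restrict q {1..n}"
  unfolding opQ_def
proof (rule restrict_ext)
  fix m assume "m \<in> {1..n}"
  then show "recQ (restrict (opF {1..} q) {1..n}) m = q m"
    by (rule recQ_inverts_opF[OF assms, rotated]) simp
qed

theorem lemma2p3:
  fixes n :: nat
  assumes "n \<ge> 1"
  shows "opF {1..n} ` initial_segments n seqQ = initial_segments n seqF \<and>
    opQ {1..n} ` initial_segments n seqF = initial_segments n seqQ"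
  unfolding initial_segments_def seqF_def image_image
  using opF_restrict opQ_restrict_opF by (intro conjI image_cong) auto

end
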